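(* Let $V_0\in\mathbb{C}^{n\times k}$, and suppose that $(\overline{x},\overline{V},\overline{\Lambda})$ is an optimal solution of the convex program $\mathcal{P}_{\rm III}(V_0)$: $$\begin{aligned}\text{minimize}\quad & \mathrm{Tr}(M H_0(V,V_0))\\ \text{subject to}\quad & x\in\mathbb{R}^{2n},\ V\in\mathbb{C}^{n\times k},\ \Lambda\in\mathbb{R}^{m\times \ell},\\ & H_i(V,V_0)-C_i+(b_i^Tx)e_1e_1^T-\sum_{j=1}^{\ell}[\Lambda]_{ij}W_j\preceq 0,\quad i=1,\dots,m,\\ & Ex\le f,\quad \Lambda\le 0.\end{aligned}$$ Define $\overline{v}\in\mathcal{L}^2_{k,n}$ by $\overline{v}(\boldsymbol{\xi})=\overline{V}\boldsymbol{\xi}$. Then $(\overline{x},\overline{v})$ is a feasible solution of the problem $\mathcal{P}$: $$\begin{aligned}\text{minimize}\quad & \mathbb{E}\left[v(\boldsymbol{\xi})^HA_0v(\boldsymbol{\xi})\right]\\ \text{subject to}\quad & x\in\mathbb{R}^{2n},\ v\in\mathcal{L}^2_{k,n},\\ & v(\xi)^HA_iv(\xi)+b_i^Tx\le c_i^T\xi,\quad i=1,\dots,m,\ \ \forall\,\xi\in\Xi,\\ & Ex\le f.\end{aligned}$$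
   Context: Notation. $e_i$ is the $i$-th standard basis vector (dimension clear from context); $X^H$ is conjugate transpose; $\mathbf{j}$ is the imaginary unit; $X\preceq 0$ ($X\succeq 0$) means Hermitian negative (positive) semidefinite; inequalities between real vectors or matrices (e.g. $\Lambda\le 0$, $Ex\le f$) are entrywise; for complex numbers, $z_1\le z_2$ means $\mathrm{Re}\,z_1\le\mathrm{Re}\,z_2$ and $\mathrm{Im}\,z_1\le \mathrm{Im}\,z_2$; $\mathrm{Re}$ and $\mathrm{Im}$ of vectors are entrywise. $\mathcal{L}^2_{k,n}$ is the space of square-integrable (with respect to the law of $\boldsymbol{\xi}$) Borel measurable functions $\mathbb{R}^k\to\mathbb{C}^n$. Uncertainty. $\boldsymbol{\xi}$ is a random vector in $\mathbb{R}^k$ with second-moment matrix $M=\mathbb{E}[\boldsymbol{\xi}\boldsymbol{\xi}^T]$, whose support is the nonempty compact set $\Xi=\{\xi\in\mathbb{R}^k: \xi_1=1,\ \xi^TW_j\xi\ge 0,\ j=1,\dots,\ell\}$, where $W_j=\begin{bmatrix}\omega_j & w_j^T\\ w_j & -\Omega_j^T\Omega_j\end{bmatrix}\in\mathbb{R}^{k\times k}$, $\omega_j\in\mathbb{R}$, $w_j\in\mathbb{R}^{k-1}$, $\Omega_j\in\mathbb{R}^{n_j\times(k-1)}$. It is assumed that some $\xi\in\Xi$ satisfies $\xi^TW_j\xi>0$ for all $j$ (which implies that $M$ is positive definite). Network. $\mathcal{V}=\{1,\dots,n\}$ is the set of buses and $\mathcal{E}\subseteq\mathcal{V}\times\mathcal{V}$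 the set of lines, with $(i,j)\in\mathcal{E}$ iff $(j,i)\in\mathcal{E}$. $Y\in\mathbb{C}^{n\times n}$ is the bus admittance matrix, $\widehat{y}_{ij}\in\mathbb{C}$ the shunt admittance of line $(i,j)$. Set $S_i=Y^He_ie_i^T$, $\Phi_i=(S_i+S_i^H)/2$, $\Psi_i=(S_i-S_i^H)/(2\mathbf{j})$ for $i\in\mathcal{V}$, and for $(i,j)\in\mathcal{E}$, $S_{ij}=e_ie_i^T(\widehat{y}_{ij}/2-[Y]_{ij})^H+e_je_i^T[Y]_{ij}^H$, $P_{ij}=(S_{ij}+S_{ij}^H)/2$. Parameters. For each bus $i$: marginal cost $\alpha_i\ge 0$, demand $d_i\in\mathbb{C}$, capacities $g_i^{\min},g_i^{\max}\in\mathbb{C}$ (stacked into vectors $g^{\min},g^{\max}$), ramp limits $r_i^{\min},r_i^{\max}\in\mathbb{C}$, voltage limits $v_i^{\min},v_i^{\max}\in\mathbb{R}$; for each line, flow capacity $\ell_{ij}^{\max}\in\mathbb{R}$. Real-time capacity bounds are $\underline{g}(\xi)=\underline{G}\xi$, $\overline{g}(\xi)=\overline{G}\xi$ with $\underline{G},\overline{G}\in\mathbb{C}^{n\times k}$, and $g_i^{\min}\le\underline{g}_i(\xi)\le\overline{g}_i(\xi)\le g_i^{\max}$ for all $\xi\in\Xi$, $i\in\mathcal{V}$. Problem data. $A_0=\sum_{i=1}^n\alpha_i\Phi_i$. With $m=10n+2|\mathcal{E}|$, the triples $(A_i,b_i,c_i)$, $i=1,\dots,m$, with $A_i\in\mathbb{C}^{n\times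 n}$ Hermitian, $b_i\in\mathbb{R}^{2n}$, $c_i\in\mathbb{R}^k$, enumerate the following: for every $i\in\mathcal{V}$, the ten triples $(\Phi_i,\,0,\,\mathrm{Re}\{\overline{G}^Te_i-d_ie_1\})$, $(-\Phi_i,\,0,\,\mathrm{Re}\{d_ie_1-\underline{G}^Te_i\})$, $(\Psi_i,\,0,\,\mathrm{Im}\{\overline{G}^Te_i-d_ie_1\})$, $(-\Psi_i,\,0,\,\mathrm{Im}\{d_ie_1-\underline{G}^Te_i\})$, $(\Phi_i,\,-e_i,\,\mathrm{Re}\{r_i^{\max}-d_i\}e_1)$, $(-\Phi_i,\,e_i,\,\mathrm{Re}\{d_i-r_i^{\min}\}e_1)$, $(\Psi_i,\,-e_{n+i},\,\mathrm{Im}\{r_i^{\max}-d_i\}e_1)$, $(-\Psi_i,\,e_{n+i},\,\mathrm{Im}\{d_i-r_i^{\min}\}e_1)$, $(e_ie_i^T,\,0,\,(v_i^{\max})^2e_1)$, $(-e_ie_i^T,\,0,\,-(v_i^{\min})^2e_1)$; and for every $(i,j)\in\mathcal{E}$, the two triples $(P_{ij},\,0,\,\ell_{ij}^{\max}e_1)$, $(-P_{ij},\,0,\,\ell_{ij}^{\max}e_1)$. Also $E=\begin{bmatrix}I_{2n}&-I_{2n}\end{bmatrix}^T\in\mathbb{R}^{4n\times 2n}$, $f=[\mathrm{Re}\{g^{\max}\}^T,\ \mathrm{Im}\{g^{\max}\}^T,\ -\mathrm{Re}\{g^{\min}\}^T,\ -\mathrm{Im}\{g^{\min}\}^T]^T\in\mathbb{R}^{4n}$,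 and $C_i=(e_1c_i^T+c_ie_1^T)/2$. Majorizers. For $i=0,1,\dots,m$, write $A_i=A_i^++A_i^-$ with $A_i^+\succeq0$ and $A_i^-\preceq0$ the positive and negative semidefinite parts of $A_i$, and for $V,Z\in\mathbb{C}^{n\times k}$ let $H_i(V,Z)=V^HA_i^+V+Z^HA_i^-V+V^HA_i^-Z-Z^HA_i^-Z$. *)

theory Defs
  imports "HOL-Probability.Probability" "HOL-Library.Multiset"
begin

text \<open>
  Conventions.  Buses are the elements of a finite type \<open>'n\<close>, and the coordinates of the uncertainty
  vector are the elements of a finite type \<open>'k\<close> with a designated element \<open>k1\<close> in the role of the
  first coordinate; the remaining \<open>k - 1\<close> coordinates are the elements of \<open>'k\<close> different from \<open>k1\<close>.
  Stacked vectors of dimensions \<open>2n\<close> and \<open>4n\<close> are indexed by \<open>'n + 'n\<close> and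
  \<open>('n + 'n) + ('n + 'n)\<close>, where \<open>Inl\<close> addresses the upper block.  In matrix types,
  \<open>'a ^ 'c ^ 'r\<close> has rows indexed by \<open>'r\<close> and columns by \<open>'c\<close>.  Complex numbers are ordered
  componentwise in real and imaginary part.
\<close>

definition adj :: "complex ^ 'c ^ 'r \<Rightarrow> complex ^ 'r ^ 'c" where
  "adj X = (\<chi> i j. cnj (X $ j $ i))"

definition outer :: "'a::times ^ 'r \<Rightarrow> 'a ^ 'c \<Rightarrow> 'a ^ 'c ^ 'r" where
  "outer u v = (\<chi> i j. u $ i * v $ j)"

definition diag :: "complex ^ 'n \<Rightarrow> complex ^ 'n ^ 'n" where
  "diag u = (\<chi> i j. if i = j then u $ i else 0)"

definition cvec :: "real ^ 'n \<Rightarrow> complex ^ 'n" where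
  "cvec x = (\<chi> i. complex_of_real (x $ i))"

definition Re_vec :: "complex ^ 'n \<Rightarrow> real ^ 'n" where
  "Re_vec z = (\<chi> i. Re (z $ i))"

definition Im_vec :: "complex ^ 'n \<Rightarrow> real ^ 'n" where
  "Im_vec z = (\<chi> i. Im (z $ i))"

abbreviation cmat :: "real ^ 'c ^ 'r \<Rightarrow> complex ^ 'c ^ 'r" where
  "cmat X \<equiv> map_matrix complex_of_real X"

definition cle :: "complex \<Rightarrow> complex \<Rightarrow> bool" (infix "\<le>\<^sub>C" 50) where
  "z1 \<le>\<^sub>C z2 \<longleftrightarrow> Re z1 \<le> Re z2 \<and> Im z1 \<le> Im z2"

definition qform :: "complex ^ 'n ^ 'n \<Rightarrow> complex ^ 'n \<Rightarrow> complex" where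
  "qform A z = (\<Sum>i\<in>UNIV. cnj (z $ i) * (A *v z) $ i)"

definition hermitian :: "complex ^ 'n ^ 'n \<Rightarrow> bool" where
  "hermitian A \<longleftrightarrow> adj A = A"

text \<open>The quadratic form of a Hermitian matrix is real, so its real part is the whole value.\<close>

definition nsd :: "complex ^ 'n ^ 'n \<Rightarrow> bool" where
  "nsd A \<longleftrightarrow> hermitian A \<and> (\<forall>z. Re (qform A z) \<le> 0)"

text \<open>
  Positive and negative semidefinite parts of a Hermitian matrix: in a unitary diagonalization,
  keep the positive, respectively the negative, eigenvalues.
\<close>

definition semidefinite_parts ::
    "complex ^ 'n ^ 'n \<Rightarrow> complex ^ 'n ^ 'n \<Rightarrow> complex ^ 'n ^ 'n \<Rightarrow> bool" where
  "semidefinite_parts A Ap An \<longleftrightarrow>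
     (\<exists>(U :: complex ^ 'n ^ 'n) (lam :: real ^ 'n).
        adj U ** U = mat 1 \<and>
        A = U ** diag (cvec lam) ** adj U \<and>
        Ap = U ** diag (cvec (\<chi> i. max (lam $ i) 0)) ** adj U \<and>
        An = U ** diag (cvec (\<chi> i. min (lam $ i) 0)) ** adj U)"

definition majorizer ::
    "complex ^ 'n ^ 'n \<Rightarrow> complex ^ 'n ^ 'n \<Rightarrow> complex ^ 'k ^ 'n \<Rightarrow> complex ^ 'k ^ 'n \<Rightarrow> complex ^ 'k ^ 'k"
    where
  "majorizer Ap An V Z =
     adj V ** Ap ** V + adj Z ** An ** V + adj V ** An ** Z - adj Z ** An ** Z"

definition measure_support :: "'a::topological_space measure \<Rightarrow> 'a set" where
  "measure_support \<mu> = {x. \<forall>U. open U \<longrightarrow> x \<in> U \<longrightarrow> 0 < emeasure \<mu> U}"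

definition second_moment :: "'w measure \<Rightarrow> ('w \<Rightarrow> real ^ 'k) \<Rightarrow> real ^ 'k ^ 'k" where
  "second_moment P \<xi> = (\<chi> a b. \<integral>w. \<xi> w $ a * \<xi> w $ b \<partial>P)"

text \<open>
  The block matrix with rows \<open>[\<omega>, w\<^sup>T]\<close> and \<open>[w, - \<Omega>\<^sup>T \<Omega>]\<close>.  The matrix \<open>\<Omega>\<close> has rows
  \<open>1..N\<close> and columns the elements of \<open>'k\<close> different from \<open>k1\<close>; values of \<open>w\<close> and \<open>\<Omega>\<close> at \<open>k1\<close> are
  not used.
\<close>

definition block_W :: "'k \<Rightarrow> real \<Rightarrow> ('k \<Rightarrow> real) \<Rightarrow> nat \<Rightarrow> (nat \<Rightarrow> 'k \<Rightarrow> real) \<Rightarrow> real ^ 'k ^ 'k" where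
  "block_W k1 \<omega> w N \<Omega> =
     (\<chi> a b. if a = k1 \<and> b = k1 then \<omega>
             else if a = k1 then w b
             else if b = k1 then w a
             else - (\<Sum>r = 1..N. \<Omega> r a * \<Omega> r b))"

definition uncertainty_set :: "'k \<Rightarrow> nat \<Rightarrow> (nat \<Rightarrow> real ^ 'k ^ 'k) \<Rightarrow> (real ^ 'k) set" where
  "uncertainty_set k1 l W = {\<xi>. \<xi> $ k1 = 1 \<and> (\<forall>j\<in>{1..l}. \<xi> \<bullet> (W j *v \<xi>) \<ge> 0)}"

definition L2_space :: "(real ^ 'k) measure \<Rightarrow> (real ^ 'k \<Rightarrow> complex ^ 'n) set" where
  "L2_space \<mu> = {v. v \<in> borel_measurable borel \<and> integrable \<mu> (\<lambda>\<xi>. (norm (v \<xi>))\<^sup>2)}"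

record ('n::finite, 'k::finite) network =
  lines :: "('n \<times> 'n) set"
  Ybus :: "complex ^ 'n ^ 'n"
  shunt :: "'n \<Rightarrow> 'n \<Rightarrow> complex"
  cost :: "real ^ 'n"
  demand :: "complex ^ 'n"
  gmin :: "complex ^ 'n"
  gmax :: "complex ^ 'n"
  rmin :: "complex ^ 'n"
  rmax :: "complex ^ 'n"
  vmin :: "real ^ 'n"
  vmax :: "real ^ 'n"
  linecap :: "'n \<Rightarrow> 'n \<Rightarrow> real"
  Glow :: "complex ^ 'k ^ 'n"
  Gup :: "complex ^ 'k ^ 'n"

definition S_bus :: "('n::finite, 'k::finite) network \<Rightarrow> 'n \<Rightarrow> complex ^ 'n ^ 'n" where
  "S_bus net i = adj (Ybus net) ** outer (axis i 1) (axis i 1)"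

definition Phi :: "('n::finite, 'k::finite) network \<Rightarrow> 'n \<Rightarrow> complex ^ 'n ^ 'n" where
  "Phi net i = map_matrix (\<lambda>z. z / 2) (S_bus net i + adj (S_bus net i))"

definition Psi :: "('n::finite, 'k::finite) network \<Rightarrow> 'n \<Rightarrow> complex ^ 'n ^ 'n" where
  "Psi net i = map_matrix (\<lambda>z. z / (2 * \<i>)) (S_bus net i - adj (S_bus net i))"

definition S_line :: "('n::finite, 'k::finite) network \<Rightarrow> 'n \<Rightarrow> 'n \<Rightarrow> complex ^ 'n ^ 'n" where
  "S_line net i j =
     map_matrix (\<lambda>z. z * cnj (shunt net i j / 2 - Ybus net $ i $ j)) (outer (axis i 1) (axis i 1))
     + map_matrix (\<lambda>z. z * cnj (Ybus net $ i $ j)) (outer (axis j 1) (axis i 1))"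

definition P_line :: "('n::finite, 'k::finite) network \<Rightarrow> 'n \<Rightarrow> 'n \<Rightarrow> complex ^ 'n ^ 'n" where
  "P_line net i j = map_matrix (\<lambda>z. z / 2) (S_line net i j + adj (S_line net i j))"

definition cost_matrix :: "('n::finite, 'k::finite) network \<Rightarrow> complex ^ 'n ^ 'n" where
  "cost_matrix net = (\<Sum>i\<in>UNIV. cost net $ i *\<^sub>R Phi net i)"

definition bus_triples :: "'k \<Rightarrow> ('n::finite, 'k::finite) network \<Rightarrow> 'n \<Rightarrow>
    ((complex ^ 'n ^ 'n) \<times> (real ^ ('n + 'n)) \<times> (real ^ 'k)) multiset" where
  "bus_triples k1 net i =
    {# (Phi net i, 0, Re_vec (transpose (Gup net) *v axis i 1 - demand net $ i *s axis k1 1)),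
       (- Phi net i, 0, Re_vec (demand net $ i *s axis k1 1 - transpose (Glow net) *v axis i 1)),
       (Psi net i, 0, Im_vec (transpose (Gup net) *v axis i 1 - demand net $ i *s axis k1 1)),
       (- Psi net i, 0, Im_vec (demand net $ i *s axis k1 1 - transpose (Glow net) *v axis i 1)),
       (Phi net i, - axis (Inl i) 1, Re (rmax net $ i - demand net $ i) *s axis k1 1),
       (- Phi net i, axis (Inl i) 1, Re (demand net $ i - rmin net $ i) *s axis k1 1),
       (Psi net i, - axis (Inr i) 1, Im (rmax net $ i - demand net $ i) *s axis k1 1),
       (- Psi net i, axis (Inr i) 1, Im (demand net $ i - rmin net $ i) *s axis k1 1),
       (outer (axis i 1) (axis i 1), 0, (vmax net $ i)\<^sup>2 *s axis k1 1),
       (- outer (axis i 1) (axis i 1), 0, - (vmin net $ i)\<^sup>2 *s axis k1 1) #}"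

definition line_triples :: "'k \<Rightarrow> ('n::finite, 'k::finite) network \<Rightarrow> 'n \<Rightarrow> 'n \<Rightarrow>
    ((complex ^ 'n ^ 'n) \<times> (real ^ ('n + 'n)) \<times> (real ^ 'k)) multiset" where
  "line_triples k1 net i j =
    {# (P_line net i j, 0, linecap net i j *s axis k1 1),
       (- P_line net i j, 0, linecap net i j *s axis k1 1) #}"

text \<open>A multiset, since distinct constraints may give equal triples and their order is irrelevant.\<close>

definition constraint_triples :: "'k \<Rightarrow> ('n::finite, 'k::finite) network \<Rightarrow>
    ((complex ^ 'n ^ 'n) \<times> (real ^ ('n + 'n)) \<times> (real ^ 'k)) multiset" where
  "constraint_triples k1 net =
     (\<Sum>i\<in>UNIV. bus_triples k1 net i) + (\<Sum>(i, j)\<in>lines net. line_triples k1 net i j)"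

definition E_mat :: "real ^ ('n + 'n) ^ (('n::finite + 'n) + ('n + 'n))" where
  "E_mat = (\<chi> r c. case r of Inl a \<Rightarrow> mat 1 $ a $ c | Inr a \<Rightarrow> - (mat 1 $ a $ c))"

definition f_vec :: "complex ^ 'n \<Rightarrow> complex ^ 'n \<Rightarrow> real ^ (('n::finite + 'n) + ('n + 'n))" where
  "f_vec gmn gmx = (\<chi> r. case r of
       Inl (Inl i) \<Rightarrow> Re (gmx $ i)
     | Inl (Inr i) \<Rightarrow> Im (gmx $ i)
     | Inr (Inl i) \<Rightarrow> - Re (gmn $ i)
     | Inr (Inr i) \<Rightarrow> - Im (gmn $ i))"

definition C_mat :: "'k \<Rightarrow> real ^ 'k \<Rightarrow> real ^ 'k ^ 'k" where
  "C_mat k1 c = (1 / 2) *\<^sub>R (outer (axis k1 1) c + outer c (axis k1 1))"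

text \<open>A minimization problem is a pair of an objective and a feasible set.\<close>

type_synonym 'a min_problem = "('a \<Rightarrow> real) \<times> 'a set"

definition feasible_solution :: "'a min_problem \<Rightarrow> 'a \<Rightarrow> bool" where
  "feasible_solution p z \<longleftrightarrow> z \<in> snd p"

definition optimal_solution :: "'a min_problem \<Rightarrow> 'a \<Rightarrow> bool" where
  "optimal_solution p z \<longleftrightarrow> feasible_solution p z \<and> (\<forall>y. feasible_solution p y \<longrightarrow> fst p z \<le> fst p y)"

text \<open>
  The matrices \<open>A 0, \<dots>, A m\<close> are Hermitian, so the
  objective is real.
\<close>

definition problem_P ::
    "'w measure \<Rightarrow> ('w \<Rightarrow> real ^ 'k) \<Rightarrow> (real ^ 'k) set \<Rightarrow> complex ^ 'n \<Rightarrow> complex ^ 'n \<Rightarrow>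
     nat \<Rightarrow> (nat \<Rightarrow> complex ^ 'n ^ 'n) \<Rightarrow> (nat \<Rightarrow> real ^ ('n + 'n)) \<Rightarrow> (nat \<Rightarrow> real ^ 'k) \<Rightarrow>
     ((real ^ ('n::finite + 'n)) \<times> (real ^ 'k \<Rightarrow> complex ^ 'n)) min_problem" where
  "problem_P P \<xi> Xi gmn gmx m A b c =
     ((\<lambda>(x, v). Re (\<integral>w. qform (A 0) (v (\<xi> w)) \<partial>P)),
      {(x, v). v \<in> L2_space (distr P borel \<xi>) \<and>
         (\<forall>i\<in>{1..m}. \<forall>y\<in>Xi.
            qform (A i) (v y) + complex_of_real (b i \<bullet> x) \<le>\<^sub>C complex_of_real (c i \<bullet> y)) \<and>
         E_mat *v x \<le> f_vec gmn gmx})"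

text \<open>
  The \<open>m \<times> l\<close> matrix \<open>\<Lambda>\<close> is a function on index pairs, of which only
  the values on \<open>{1..m} \<times> {1..l}\<close> matter.  The matrix \<open>M H\<^sub>0(V, V0)\<close> is a product of two Hermitian
  matrices, so its trace is real.
\<close>

definition problem_P_III ::
    "'k \<Rightarrow> nat \<Rightarrow> (nat \<Rightarrow> real ^ 'k ^ 'k) \<Rightarrow> real ^ 'k ^ 'k \<Rightarrow> complex ^ 'n \<Rightarrow> complex ^ 'n \<Rightarrow>
     nat \<Rightarrow> (nat \<Rightarrow> complex ^ 'n ^ 'n) \<Rightarrow> (nat \<Rightarrow> complex ^ 'n ^ 'n) \<Rightarrow>
     (nat \<Rightarrow> real ^ ('n + 'n)) \<Rightarrow> (nat \<Rightarrow> real ^ 'k) \<Rightarrow> complex ^ 'k ^ 'n \<Rightarrow>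
     ((real ^ ('n::finite + 'n)) \<times> (complex ^ 'k ^ 'n) \<times> (nat \<Rightarrow> nat \<Rightarrow> real)) min_problem" where
  "problem_P_III k1 l W M gmn gmx m Ap An b c V0 =
     ((\<lambda>(x, V, \<Lambda>). Re (trace (cmat M ** majorizer (Ap 0) (An 0) V V0))),
      {(x, V, \<Lambda>).
         (\<forall>i\<in>{1..m}. nsd (majorizer (Ap i) (An i) V V0
              + cmat (- C_mat k1 (c i) + (b i \<bullet> x) *\<^sub>R outer (axis k1 1) (axis k1 1)
                      - (\<Sum>j = 1..l. \<Lambda> i j *\<^sub>R W j)))) \<and>
         E_mat *v x \<le> f_vec gmn gmx \<and>
         (\<forall>i\<in>{1..m}. \<forall>j\<in>{1..l}. \<Lambda> i j \<le> 0)})"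

end

theory Submission
  imports Defs
begin

text \<open>
  Fix a scenario \<open>y\<close> and write \<open>u = V y\<close>, \<open>z = V0 y\<close>.  Concavity of the form of \<open>An\<close> makes its
  linearization at \<open>z\<close> an upper bound, so the quadratic form of the majorizer at \<open>y\<close> dominates
  \<open>u\<^sup>H A u\<close> (lemma \<open>qform_le_majorizer\<close>); the gap is exactly \<open>- (u - z)\<^sup>H An (u - z)\<close>.
  The matrix inequality of the restricted program is an S-procedure certificate.  Evaluated at a
  point \<open>y\<close> with \<open>y $ k1 = 1\<close>, the matrices \<open>C_mat k1 c\<close> and \<open>outer (axis k1 1) (axis k1 1)\<close> produce
  the affine terms of the scenario constraint, and the multipliers contribute
  \<open>\<Sum>j. \<Lambda> i j * (y \<bullet> (W j *v y)) \<le> 0\<close>, because \<open>\<Lambda> i j \<le> 0\<close> and each factor is nonnegative on the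
  uncertainty set (lemma \<open>certificate_bound\<close>).  Chaining the two bounds gives the scenario
  constraint in its real part; its imaginary part vanishes because a matrix with a unitary
  diagonalization with real eigenvalues is Hermitian.

  What remains is that a linear policy is square integrable.  A Borel measure on a
  second-countable space is carried by its support (lemma \<open>AE_in_measure_support\<close>), and a
  continuous function is bounded on a compact support.
\<close>

section \<open>Quadratic forms\<close>

definition herm_inner :: "complex ^ 'n \<Rightarrow> complex ^ 'n \<Rightarrow> complex" where
  "herm_inner u v = (\<Sum>i\<in>UNIV. cnj (u $ i) * v $ i)"

lemma qform_eq_herm_inner: "qform A z = herm_inner z (A *v z)"
  by (simp add: qform_def herm_inner_def)

lemma herm_inner_add_right: "herm_inner u (v + w) = herm_inner u v + herm_inner u w"
  by (simp add: herm_inner_def distrib_left sum.distrib)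

lemma herm_inner_diff_right: "herm_inner u (v - w) = herm_inner u v - herm_inner u w"
  by (simp add: herm_inner_def right_diff_distrib sum_subtractf)

lemma herm_inner_diff_left: "herm_inner (u - v) w = herm_inner u w - herm_inner v w"
  by (simp add: herm_inner_def left_diff_distrib sum_subtractf)

lemma herm_inner_adj: "herm_inner u (adj X *v w) = herm_inner (X *v u) w"
proof -
  have "herm_inner u (adj X *v w) = (\<Sum>i\<in>UNIV. \<Sum>j\<in>UNIV. cnj (u $ i) * (cnj (X $ j $ i) * w $ j))"
    by (simp add: herm_inner_def adj_def matrix_vector_mult_def sum_distrib_left)
  also have "\<dots> = (\<Sum>j\<in>UNIV. \<Sum>i\<in>UNIV. cnj (u $ i) * (cnj (X $ j $ i) * w $ j))"
    by (rule sum.swap)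
  also have "\<dots> = herm_inner (X *v u) w"
    by (simp add: herm_inner_def matrix_vector_mult_def sum_distrib_left sum_distrib_right mult_ac)
  finally show ?thesis
    by simp
qed

lemma qform_add: "qform (A + B) z = qform A z + qform B z"
  by (simp add: qform_eq_herm_inner matrix_vector_mult_add_rdistrib herm_inner_add_right)

lemma qform_unitary_diag:
  "qform (U ** diag (cvec lam) ** adj U) z =
     complex_of_real (\<Sum>i\<in>UNIV. lam $ i * (cmod ((adj U *v z) $ i))\<^sup>2)"
proof -
  let ?u = "adj U *v z"
  have adj_adj: "adj (adj U) = U"
    by (simp add: adj_def vec_eq_iff)
  have diag_mult: "(diag (cvec lam) *v ?u) $ i = complex_of_real (lam $ i) * ?u $ i" for i
    by (simp add: matrix_vector_mult_def[of "diag (cvec lam)"])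
      (simp add: diag_def cvec_def if_distrib[of "\<lambda>a. a * _"] cong: if_cong)
  have "qform (U ** diag (cvec lam) ** adj U) z = herm_inner ?u (diag (cvec lam) *v ?u)"
    using herm_inner_adj[of z "adj U" "diag (cvec lam) *v ?u"]
    by (simp add: qform_eq_herm_inner adj_adj flip: matrix_vector_mul_assoc)
  also have "\<dots> = (\<Sum>i\<in>UNIV. complex_of_real (lam $ i) * (?u $ i * cnj (?u $ i)))"
    by (simp add: herm_inner_def diag_mult mult_ac)
  finally show ?thesis
    by (simp add: complex_norm_square del: of_real_power)
qed

lemma matrix_matrix_mult_add_rdistrib: "(A + B) ** C = A ** C + B ** C"
  by (simp add: matrix_matrix_mult_def vec_eq_iff distrib_right sum.distrib)

lemma semidefinite_parts_sum:
  fixes A :: "complex ^ 'n ^ 'n"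
  assumes "semidefinite_parts A Ap An"
  shows "A = Ap + An"
proof -
  obtain U :: "complex ^ 'n ^ 'n" and lam :: "real ^ 'n" where parts: "A = U ** diag (cvec lam) ** adj U"
      "Ap = U ** diag (cvec (\<chi> i. max (lam $ i) 0)) ** adj U"
      "An = U ** diag (cvec (\<chi> i. min (lam $ i) 0)) ** adj U"
    using assms unfolding semidefinite_parts_def by blast
  have "diag (cvec lam) = diag (cvec (\<chi> i. max (lam $ i) 0)) + diag (cvec (\<chi> i. min (lam $ i) 0))"
    by (auto simp: diag_def cvec_def vec_eq_iff max_def min_def)
  then show ?thesis
    unfolding parts by (simp add: matrix_add_ldistrib matrix_matrix_mult_add_rdistrib)
qed

lemma semidefinite_parts_Im_qform:
  assumes "semidefinite_parts A Ap An"
  shows "Im (qform A z) = 0"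
  using assms unfolding semidefinite_parts_def by (auto simp: qform_unitary_diag)

lemma semidefinite_parts_Re_qform_le_0:
  assumes "semidefinite_parts A Ap An"
  shows "Re (qform An z) \<le> 0"
  using assms unfolding semidefinite_parts_def
  by (auto simp: qform_unitary_diag intro!: sum_nonpos mult_nonpos_nonneg)

lemma qform_majorizer:
  "qform (majorizer Ap An V Z) y =
     qform Ap (V *v y) + herm_inner (Z *v y) (An *v (V *v y))
     + herm_inner (V *v y) (An *v (Z *v y)) - qform An (Z *v y)"
proof -
  have product: "herm_inner y ((adj X ** B ** X') *v y) = herm_inner (X *v y) (B *v (X' *v y))" for X X' B
    by (simp add: herm_inner_adj flip: matrix_vector_mul_assoc)
  show ?thesis
    by (simp add: majorizer_def qform_eq_herm_inner matrix_vector_mult_add_rdistrib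
        matrix_vector_mult_diff_rdistrib herm_inner_add_right herm_inner_diff_right product)
qed

text \<open>
  Expanding \<open>(V y - Z y)\<^sup>H An (V y - Z y) \<le> 0\<close> and moving the cross terms to the right bounds
  \<open>(V y)\<^sup>H An (V y)\<close> by the part of the majorizer that is affine in \<open>V\<close>.
\<close>

lemma qform_le_majorizer:
  assumes "semidefinite_parts A Ap An"
  shows "Re (qform A (V *v y)) \<le> Re (qform (majorizer Ap An V Z) y)"
proof -
  have "qform A (V *v y) = qform (majorizer Ap An V Z) y + qform An (V *v y - Z *v y)"
    unfolding semidefinite_parts_sum[OF assms] qform_add qform_majorizer
    by (simp add: qform_eq_herm_inner matrix_vector_mult_diff_distrib
        herm_inner_diff_left herm_inner_diff_right)
  with semidefinite_parts_Re_qform_le_0[OF assms, of "V *v y - Z *v y"] show ?thesis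
    by simp
qed

section \<open>The S-procedure certificate\<close>

lemma Re_qform_cmat: "Re (qform (cmat R) (cvec y)) = y \<bullet> (R *v y)"
  by (simp add: qform_def cvec_def map_matrix_def matrix_vector_mult_def inner_vec_def)

lemma quadratic_outer: "y \<bullet> (outer u v *v y) = (u \<bullet> y) * (v \<bullet> (y :: real ^ 'k))"
proof -
  have "outer u v *v y = (v \<bullet> y) *\<^sub>R u"
    by (simp add: outer_def matrix_vector_mult_def inner_vec_def vec_eq_iff sum_distrib_left
        sum_distrib_right mult_ac)
  then show ?thesis
    by (simp add: inner_commute)
qed

lemma quadratic_C_mat:
  assumes "y $ k1 = 1"
  shows "y \<bullet> (C_mat k1 c *v y) = c \<bullet> y"
  using assms
  by (simp add: C_mat_def matrix_vector_mult_add_rdistrib scaleR_matrix_vector_assoc[symmetric]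
      inner_add_right quadratic_outer inner_axis')

lemma quadratic_sum: "y \<bullet> ((\<Sum>j\<in>J. W j) *v y) = (\<Sum>j\<in>J. y \<bullet> (W j *v y))"
  for y :: "real ^ 'k"
  by (induction J rule: infinite_finite_induct)
    (simp_all add: matrix_vector_mult_add_rdistrib inner_add_right)

text \<open>
  The multiplier terms have the favourable sign on the uncertainty set, so discarding them from
  the inequality \<open>Re (qform (H + \<dots>) (cvec y)) \<le> 0\<close> preserves it.
\<close>

lemma certificate_bound:
  fixes W :: "nat \<Rightarrow> real ^ 'k ^ 'k"
  assumes "nsd (H + cmat (- C_mat k1 c + \<beta> *\<^sub>R outer (axis k1 1) (axis k1 1)
                           - (\<Sum>j = 1..l. mul j *\<^sub>R W j)))"
    and mul: "\<forall>j\<in>{1..l}. mul j \<le> 0"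
    and y: "y \<in> uncertainty_set k1 l W"
  shows "Re (qform H (cvec y)) + \<beta> \<le> c \<bullet> y"
proof -
  have "y $ k1 = 1"
    using y by (simp add: uncertainty_set_def)
  then have "Re (qform H (cvec y)) - c \<bullet> y + \<beta> - (\<Sum>j = 1..l. mul j * (y \<bullet> (W j *v y))) \<le> 0"
    using assms(1) unfolding nsd_def
    by (auto dest!: spec[of _ "cvec y"] simp: qform_add Re_qform_cmat quadratic_C_mat quadratic_sum
        quadratic_outer matrix_vector_mult_add_rdistrib matrix_vector_mult_diff_rdistrib
        inner_add_right inner_diff_right scaleR_matrix_vector_assoc[symmetric] inner_axis'
        uminus_add_conv_diff)
  moreover have "(\<Sum>j = 1..l. mul j * (y \<bullet> (W j *v y))) \<le> 0"
    using mul y by (auto simp: uncertainty_set_def intro!: sum_nonpos mult_nonpos_nonneg)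
  ultimately show ?thesis
    by linarith
qed

section \<open>Square integrability of linear policies\<close>

text \<open>
  Every point outside the support has a null neighbourhood, which can be shrunk to a member of a
  countable base; hence the complement of the support is covered by countably many null sets.
\<close>

lemma AE_in_measure_support:
  fixes \<mu> :: "'a::second_countable_topology measure"
  assumes sets: "sets \<mu> = sets borel"
  shows "AE x in \<mu>. x \<in> measure_support \<mu>"
proof -
  obtain B :: "'a set set" where B: "countable B" "topological_basis B"
    using ex_countable_basis by blast
  let ?N = "\<Union>{b \<in> B. emeasure \<mu> b = 0}"
  have "b \<in> null_sets \<mu>" if "b \<in> B" "emeasure \<mu> b = 0" for b
    using that topological_basis_open[OF B(2)] sets by auto
  then have "?N \<in> null_sets \<mu>"
    using B(1) null_sets_UN'[of "{b \<in> B. emeasure \<mu> b = 0}" "\<lambda>b. b" \<mu>] by auto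
  moreover have "x \<in> ?N" if "x \<notin> measure_support \<mu>" for x
  proof -
    from that obtain T where T: "open T" "x \<in> T" "emeasure \<mu> T = 0"
      by (auto simp: measure_support_def)
    obtain b where b: "b \<in> B" "x \<in> b" "b \<subseteq> T"
      using topological_basisE[OF B(2) T(1,2)] by metis
    have "emeasure \<mu> b \<le> emeasure \<mu> T"
      using b(3) T(1) sets by (intro emeasure_mono) auto
    with b T(3) show ?thesis
      by auto
  qed
  ultimately show ?thesis
    by (intro AE_I'[of ?N]) auto
qed

lemma continuous_in_L2_space:
  fixes v :: "real ^ 'k \<Rightarrow> complex ^ 'n"
  assumes "finite_measure \<mu>" and sets: "sets \<mu> = sets borel"
    and compact: "compact (measure_support \<mu>)" and cont: "continuous_on UNIV v"
  shows "v \<in> L2_space \<mu>"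
proof -
  interpret finite_measure \<mu> by fact
  have [measurable]: "v \<in> borel_measurable borel"
    using cont by (rule borel_measurable_continuous_onI)
  have "(\<lambda>y. (norm (v y))\<^sup>2) \<in> borel_measurable \<mu>"
    unfolding measurable_cong_sets[OF sets refl] by measurable
  moreover have "bounded (v ` measure_support \<mu>)"
    by (intro compact_imp_bounded compact_continuous_image compact
        continuous_on_subset[OF cont]) simp
  then obtain K where "\<forall>y \<in> measure_support \<mu>. norm (v y) \<le> K"
    by (auto simp: bounded_iff)
  then have "AE y in \<mu>. norm ((norm (v y))\<^sup>2) \<le> K\<^sup>2"
    using AE_in_measure_support[OF sets] by (auto intro!: power_mono)
  ultimately have "integrable \<mu> (\<lambda>y. (norm (v y))\<^sup>2)"
    by (intro integrable_const_bound)
  then show ?thesis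
    by (simp add: L2_space_def)
qed

lemma continuous_linear_policy:
  fixes V :: "complex ^ 'k::finite ^ 'n::finite"
  shows "continuous_on UNIV (\<lambda>y. V *v cvec y)"
  unfolding matrix_vector_mult_def cvec_def by (simp; intro continuous_intros)

section \<open>Feasibility\<close>

theorem proposition1:
  fixes P :: "'w measure"
    and \<xi> :: "'w \<Rightarrow> real ^ 'k::finite"
    and M :: "real ^ 'k ^ 'k"
    and Xi :: "(real ^ 'k) set"
    and k1 :: 'k
    and l :: nat
    and W :: "nat \<Rightarrow> real ^ 'k ^ 'k"
    and \<omega> :: "nat \<Rightarrow> real"
    and w :: "nat \<Rightarrow> 'k \<Rightarrow> real"
    and rows :: "nat \<Rightarrow> nat"
    and \<Omega> :: "nat \<Rightarrow> nat \<Rightarrow> 'k \<Rightarrow> real"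
    and net :: "('n::finite, 'k) network"
    and m :: nat
    and A Ap An :: "nat \<Rightarrow> complex ^ 'n ^ 'n"
    and b :: "nat \<Rightarrow> real ^ ('n + 'n)"
    and c :: "nat \<Rightarrow> real ^ 'k"
    and V0 V :: "complex ^ 'k ^ 'n"
    and x :: "real ^ ('n + 'n)"
    and \<Lambda> :: "nat \<Rightarrow> nat \<Rightarrow> real"
  assumes "prob_space P" and "\<xi> \<in> borel_measurable P"
    and "M = second_moment P \<xi>"
    and "\<And>j. j \<in> {1..l} \<Longrightarrow> W j = block_W k1 (\<omega> j) (w j) (rows j) (\<Omega> j)"
    and "Xi = uncertainty_set k1 l W" and "Xi \<noteq> {}" and "compact Xi"
    and "measure_support (distr P borel \<xi>) = Xi"
    and "\<exists>y\<in>Xi. \<forall>j\<in>{1..l}. y \<bullet> (W j *v y) > 0"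
    and "\<And>i j. (i, j) \<in> lines net \<longleftrightarrow> (j, i) \<in> lines net"
    and "\<And>i. cost net $ i \<ge> 0"
    and "\<And>y i. y \<in> Xi \<Longrightarrow>
           gmin net $ i \<le>\<^sub>C (Glow net *v cvec y) $ i \<and>
           (Glow net *v cvec y) $ i \<le>\<^sub>C (Gup net *v cvec y) $ i \<and>
           (Gup net *v cvec y) $ i \<le>\<^sub>C gmax net $ i"
    and "m = 10 * CARD('n) + 2 * card (lines net)"
    and "A 0 = cost_matrix net"
    and "image_mset (\<lambda>i. (A i, b i, c i)) (mset_set {1..m}) = constraint_triples k1 net"
    and "\<And>i. i \<in> {0..m} \<Longrightarrow> semidefinite_parts (A i) (Ap i) (An i)"
    and "optimal_solution
           (problem_P_III k1 l W M (gmin net) (gmax net) m Ap An b c V0) (x, V, \<Lambda>)"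
  shows "feasible_solution
           (problem_P P \<xi> Xi (gmin net) (gmax net) m A b c) (x, \<lambda>y. V *v cvec y)"
proof -
  have psd: "semidefinite_parts (A i) (Ap i) (An i)" if "i \<in> {1..m}" for i
    using that assms(16) by simp
  have feasible: "feasible_solution
      (problem_P_III k1 l W M (gmin net) (gmax net) m Ap An b c V0) (x, V, \<Lambda>)"
    using assms(17) by (simp add: optimal_solution_def)
  have "prob_space (distr P borel \<xi>)"
    using assms(1,2) by (rule prob_space.prob_space_distr)
  then have "(\<lambda>y. V *v cvec y) \<in> L2_space (distr P borel \<xi>)"
    using assms(7,8) by (intro continuous_in_L2_space continuous_linear_policy)
      (auto simp: prob_space_def)
  moreover have "qform (A i) (V *v cvec y) + complex_of_real (b i \<bullet> x) \<le>\<^sub>C complex_of_real (c i \<bullet> y)"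
    if i: "i \<in> {1..m}" and y: "y \<in> Xi" for i y
  proof -
    have "Re (qform (A i) (V *v cvec y)) \<le> Re (qform (majorizer (Ap i) (An i) V V0) (cvec y))"
      using psd[OF i] by (rule qform_le_majorizer)
    moreover have "Re (qform (majorizer (Ap i) (An i) V V0) (cvec y)) + b i \<bullet> x \<le> c i \<bullet> y"
      using feasible i y unfolding assms(5)
      by (intro certificate_bound[where mul = "\<Lambda> i" and l = l and W = W])
        (auto simp: feasible_solution_def problem_P_III_def)
    ultimately show ?thesis
      using semidefinite_parts_Im_qform[OF psd[OF i]] by (simp add: cle_def)
  qed
  moreover have "E_mat *v x \<le> f_vec (gmin net) (gmax net)"
    using feasible by (simp add: feasible_solution_def problem_P_III_def)
  ultimately show ?thesis
    by (simp add: feasible_solution_def problem_P_def)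
qed

end
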